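(* Any pseudomeadow is isomorphic to a subdirect product of fields.
   Context: A pseudoring is a commutative associative ring that is not required to have a multiplicative identity. A pseudomeadow is a pseudoring $R$ equipped with a unary operation $x\mapsto x^{(-1)}$ such that $x\,x\,x^{(-1)}=x$ and $x\,x^{(-1)}x^{(-1)}=x^{(-1)}$ for all $x\in R$. A subpseudoring $R$ of the direct product $\prod_{i\in I}R_i$ of a family of pseudorings (that is, a subset containing $0$ and closed under addition, negation and multiplication) is called a subdirect product of the family $(R_i)_{i\in I}$ if for every $i_0\in I$ and every $y\in R_{i_0}$ there is an element $(x_i)_{i\in I}\in R$ with $x_{i_0}=y$. A subdirect product of fields is a subdirect product of a family $(R_i)_{i\in I}$ in which every $R_i$ is a field. Isomorphism means a bijective map preserving addition and multiplication. *)

theory Defs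
  imports "HOL-Algebra.Algebra"
begin

text \<open>
  Pseudorings live on the \<open>ring\<close> record, so that a field of the library is literally a pseudoring.
  The record component \<open>one\<close> is never constrained or used for a pseudoring; in particular
  isomorphisms are not required to respect it, unlike those of \<open>ring_iso\<close>.
\<close>

locale pseudoring = abelian_group R for R (structure) +
  assumes m_closed: "\<lbrakk> x \<in> carrier R; y \<in> carrier R \<rbrakk> \<Longrightarrow> x \<otimes> y \<in> carrier R"
    and m_assoc: "\<lbrakk> x \<in> carrier R; y \<in> carrier R; z \<in> carrier R \<rbrakk>
      \<Longrightarrow> (x \<otimes> y) \<otimes> z = x \<otimes> (y \<otimes> z)"
    and m_comm: "\<lbrakk> x \<in> carrier R; y \<in> carrier R \<rbrakk> \<Longrightarrow> x \<otimes> y = y \<otimes> x"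
    and l_distr: "\<lbrakk> x \<in> carrier R; y \<in> carrier R; z \<in> carrier R \<rbrakk>
      \<Longrightarrow> (x \<oplus> y) \<otimes> z = x \<otimes> z \<oplus> y \<otimes> z"

locale pseudomeadow = pseudoring R for R (structure) +
  fixes pinv :: "'a \<Rightarrow> 'a"
  assumes pinv_closed: "x \<in> carrier R \<Longrightarrow> pinv x \<in> carrier R"
    and mult_mult_pinv: "x \<in> carrier R \<Longrightarrow> x \<otimes> x \<otimes> pinv x = x"
    and mult_pinv_pinv: "x \<in> carrier R \<Longrightarrow> x \<otimes> pinv x \<otimes> pinv x = pinv x"

definition direct_product :: "'i set \<Rightarrow> ('i \<Rightarrow> ('a, 'm) ring_scheme) \<Rightarrow> ('i \<Rightarrow> 'a) ring"
  where "direct_product I R =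
    \<lparr> carrier = (\<Pi>\<^sub>E i\<in>I. carrier (R i)),
      monoid.mult = (\<lambda>x y. \<lambda>i\<in>I. x i \<otimes>\<^bsub>R i\<^esub> y i),
      one = (\<lambda>i\<in>I. \<one>\<^bsub>R i\<^esub>),
      ring.zero = (\<lambda>i\<in>I. \<zero>\<^bsub>R i\<^esub>),
      ring.add = (\<lambda>x y. \<lambda>i\<in>I. x i \<oplus>\<^bsub>R i\<^esub> y i) \<rparr>"

locale subpseudoring =
  fixes S and R (structure)
  assumes subset: "S \<subseteq> carrier R"
    and zero_mem: "\<zero> \<in> S"
    and add_mem: "\<lbrakk> x \<in> S; y \<in> S \<rbrakk> \<Longrightarrow> x \<oplus> y \<in> S"
    and a_inv_mem: "x \<in> S \<Longrightarrow> \<ominus> x \<in> S"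
    and mult_mem: "\<lbrakk> x \<in> S; y \<in> S \<rbrakk> \<Longrightarrow> x \<otimes> y \<in> S"

locale subdirect_product =
  fixes I :: "'i set" and R :: "'i \<Rightarrow> ('a, 'm) ring_scheme" and S :: "('i \<Rightarrow> 'a) set"
  assumes factor: "i \<in> I \<Longrightarrow> pseudoring (R i)"
    and sub: "subpseudoring S (direct_product I R)"
    and surj: "\<lbrakk> i \<in> I; y \<in> carrier (R i) \<rbrakk> \<Longrightarrow> \<exists>x\<in>S. x i = y"

locale subdirect_product_of_fields = subdirect_product +
  assumes field_factor: "i \<in> I \<Longrightarrow> field (R i)"

definition pseudoring_iso ::
    "('a, 'm) ring_scheme \<Rightarrow> ('b, 'n) ring_scheme \<Rightarrow> ('a \<Rightarrow> 'b) set"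
  where "pseudoring_iso R S = {h. bij_betw h (carrier R) (carrier S) \<and>
    (\<forall>x\<in>carrier R. \<forall>y\<in>carrier R.
      h (x \<oplus>\<^bsub>R\<^esub> y) = h x \<oplus>\<^bsub>S\<^esub> h y \<and> h (x \<otimes>\<^bsub>R\<^esub> y) = h x \<otimes>\<^bsub>S\<^esub> h y)}"

lemma pseudoring_direct_product:
  assumes R: "\<And>i. i \<in> I \<Longrightarrow> pseudoring (R i)"
  shows "pseudoring (direct_product I R)"
proof -
  have ag: "abelian_group (R i)" if "i \<in> I" for i
    using R[OF that] by (simp add: pseudoring_def)
  note am = abelian_group.axioms(1)[OF ag]
  have "abelian_group (direct_product I R)"
  proof (rule abelian_groupI, goal_cases)
    case (6 x)
    let ?y = "\<lambda>i\<in>I. \<ominus>\<^bsub>R i\<^esub> x i"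
    have x: "x i \<in> carrier (R i)" if "i \<in> I" for i
      using 6 that by (auto simp: direct_product_def PiE_iff)
    have "?y \<in> carrier (direct_product I R)"
      using x abelian_group.a_inv_closed[OF ag] by (auto simp: direct_product_def)
    moreover have "?y \<oplus>\<^bsub>direct_product I R\<^esub> x = \<zero>\<^bsub>direct_product I R\<^esub>"
      using x abelian_group.l_neg[OF ag] by (auto simp: direct_product_def intro!: restrict_ext)
    ultimately show ?case by blast
  qed (use am in \<open>auto simp: direct_product_def PiE_iff abelian_monoid.a_closed
      abelian_monoid.zero_closed abelian_monoid.a_assoc abelian_monoid.l_zero
      fun_eq_iff extensional_def intro: abelian_monoid.a_comm\<close>)
  then show ?thesis
    by (rule pseudoring.intro, unfold_locales)
      (use R in \<open>auto simp: direct_product_def PiE_iff pseudoring.m_closed pseudoring.m_assoc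
        pseudoring.l_distr intro!: restrict_ext pseudoring.m_comm\<close>)
qed

lemma pseudoring_field:
  assumes "field F" shows "pseudoring F"
proof -
  interpret field F by fact
  show ?thesis by unfold_locales (auto simp: m_assoc l_distr intro: m_comm)
qed

end

(*
  In a pseudomeadow every element a is a multiple of the idempotent e = a a^(-1), and the ideal
  generated by an ideal P and an element x is P + R x.  Let e be an idempotent and P an ideal
  maximal among those not containing e.  For x outside P, maximality gives e = p + s x with p in P.
  Applied to x = r - e r, which e annihilates, this would put e = e p into P; so e acts as an
  identity modulo P, and then s is an inverse of x modulo P.  Hence R / P is a field in which a
  nonzero a survives, and R embeds into the product of all its quotients that are fields.
*)
theory Submission
  imports Defs
begin

section \<open>Arithmetic in a pseudoring\<close>

context pseudoring
begin

lemma r_distr: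
  assumes "x \<in> carrier R" "y \<in> carrier R" "z \<in> carrier R"
  shows "x \<otimes> (y \<oplus> z) = x \<otimes> y \<oplus> x \<otimes> z"
  using assms l_distr[of y z x] m_comm[of x] by (simp add: m_closed)

lemma l_null: "x \<in> carrier R \<Longrightarrow> \<zero> \<otimes> x = \<zero>"
  using l_distr[of \<zero> \<zero> x] by (simp add: m_closed)

lemma l_minus:
  assumes "x \<in> carrier R" "y \<in> carrier R"
  shows "(\<ominus> x) \<otimes> y = \<ominus> (x \<otimes> y)"
  using assms l_distr[of "\<ominus> x" x y] by (simp add: m_closed l_neg l_null minus_equality)

lemma m_lcomm:
  assumes "x \<in> carrier R" "y \<in> carrier R" "z \<in> carrier R"
  shows "x \<otimes> (y \<otimes> z) = y \<otimes> (x \<otimes> z)"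
  using assms by (metis m_assoc m_comm)

end

section \<open>Ideals and their quotients\<close>

locale pseudoring_ideal = pseudoring R + abelian_subgroup J R
  for J and R (structure) +
  assumes I_r_closed: "\<lbrakk>a \<in> J; x \<in> carrier R\<rbrakk> \<Longrightarrow> a \<otimes> x \<in> J"
begin

lemma I_l_closed: "\<lbrakk>a \<in> J; x \<in> carrier R\<rbrakk> \<Longrightarrow> x \<otimes> a \<in> J"
  using I_r_closed m_comm a_Hcarr by metis

lemma coset_eq_iff:
  assumes "x \<in> carrier R" "y \<in> carrier R"
  shows "J +> x = J +> y \<longleftrightarrow> x \<oplus> \<ominus> y \<in> J"
  using assms a_rcos_module[of y x] a_repr_independence'[of x y] a_repr_independenceD[of x y]
  by metis

lemma coset_eq_self_iff:
  assumes "x \<in> carrier R"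
  shows "J +> x = J \<longleftrightarrow> x \<in> J"
  using assms a_rcos_self a_rcos_const by metis

text \<open>\<open>rcoset_mult\<close> is the union of the cosets of all products of
  representatives. For h, k in J, (h + x)(k + y) differs from x y by h (k + y) + x k, which lies in
  J, so all these cosets coincide.\<close>

lemma rcoset_mult_eq:
  assumes "x \<in> carrier R" "y \<in> carrier R"
  shows "[mod J:] (J +> x) \<Otimes> (J +> y) = J +> (x \<otimes> y)"
proof -
  have "J +> (x' \<otimes> y') = J +> (x \<otimes> y)" if mem: "x' \<in> J +> x" "y' \<in> J +> y" for x' y'
  proof -
    obtain h k where h: "h \<in> J" "x' = h \<oplus> x" and k: "k \<in> J" "y' = k \<oplus> y"
      using mem by (auto simp: a_r_coset_def')
    have c: "h \<in> carrier R" "k \<in> carrier R"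
      using h k by auto
    have "x' \<otimes> y' = (h \<otimes> (k \<oplus> y) \<oplus> x \<otimes> k) \<oplus> x \<otimes> y"
      using assms c h k by (simp add: l_distr r_distr m_closed a_ac)
    moreover have "h \<otimes> (k \<oplus> y) \<oplus> x \<otimes> k \<in> J"
      using assms c h k by (simp add: I_l_closed I_r_closed)
    ultimately have "x' \<otimes> y' \<in> J +> (x \<otimes> y)"
      by (auto simp: a_r_coset_def')
    then show ?thesis
      using a_repr_independence' assms m_closed by metis
  qed
  \<comment> \<open>Both cosets are nonempty, so the union is the common coset rather than the empty
    set.\<close>
  moreover have "x \<in> J +> x" "y \<in> J +> y"
    using assms a_rcos_self by auto
  ultimately show ?thesis
    unfolding rcoset_mult_def by blast
qed

text \<open>The additive structure does not see the field \<open>one\<close>, hence the arbitrary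
  \<open>u\<close>.\<close>

lemma quotient_abelian_group: "abelian_group ((R Quot J)\<lparr>one := u\<rparr>)"
  by (rule comm_group_abelian_groupI)
    (simp add: FactRing_def a_factorgroup_is_comm_group[unfolded A_FactGroup_def'])

text \<open>The quotient can have an identity even if R has none: by \<open>id\<close> the coset of
  e acts as one, and it is nonzero as e is outside J. \<open>Quot\<close> fills \<open>one\<close>
  with the coset of the unconstrained \<open>one\<close> of R, so that field is overwritten.\<close>

lemma quotient_fieldI:
  assumes e: "e \<in> carrier R" "e \<notin> J"
    and id: "\<And>r. r \<in> carrier R \<Longrightarrow> r \<oplus> \<ominus> (e \<otimes> r) \<in> J"
    and inv: "\<And>x. \<lbrakk>x \<in> carrier R; x \<notin> J\<rbrakk> \<Longrightarrow> \<exists>s\<in>carrier R. e \<oplus> \<ominus> (s \<otimes> x) \<in> J"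
  shows "field ((R Quot J)\<lparr>one := J +> e\<rparr>)" (is "field ?Q")
proof -
  have carrier: "carrier (R Quot J) = (\<lambda>x. J +> x) ` carrier R"
    by (auto simp: FactRing_def A_RCOSETS_def')
  have mult: "(J +> x) \<otimes>\<^bsub>R Quot J\<^esub> (J +> y) = J +> (x \<otimes> y)"
    if "x \<in> carrier R" "y \<in> carrier R" for x y
    using that by (simp add: FactRing_def rcoset_mult_eq)
  have add: "(J +> x) \<oplus>\<^bsub>R Quot J\<^esub> (J +> y) = J +> (x \<oplus> y)"
    if "x \<in> carrier R" "y \<in> carrier R" for x y
    using that by (simp add: FactRing_def a_rcos_sum)
  have e_id: "J +> (e \<otimes> r) = J +> r" if "r \<in> carrier R" for r
    using coset_eq_iff[of r "e \<otimes> r"] that e id by (simp add: m_closed)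
  have e_id': "J +> (r \<otimes> e) = J +> r" if "r \<in> carrier R" for r
    using e_id that e m_comm by metis
  have "cring ?Q"
  proof (rule cringI)
    show "comm_monoid ?Q"
      by (rule comm_monoidI)
        (use e in \<open>auto simp: carrier mult e_id e_id' m_closed m_assoc m_comm m_lcomm\<close>)
  qed (auto simp: quotient_abelian_group carrier mult add m_closed l_distr)
  then interpret Q: cring ?Q .
  show ?thesis
  proof (rule Q.cring_fieldI2)
    show "\<zero>\<^bsub>?Q\<^esub> \<noteq> \<one>\<^bsub>?Q\<^esub>"
      using e coset_eq_self_iff[of e] by (simp add: FactRing_def)
    fix A assume "A \<in> carrier ?Q" and nz: "A \<noteq> \<zero>\<^bsub>?Q\<^esub>"
    then obtain x where x: "x \<in> carrier R" "A = J +> x"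
      by (auto simp: carrier)
    then have "x \<notin> J"
      using nz coset_eq_self_iff[of x] by (simp add: FactRing_def)
    then obtain s where s: "s \<in> carrier R" "e \<oplus> \<ominus> (s \<otimes> x) \<in> J"
      using inv x by blast
    then have "J +> (x \<otimes> s) = J +> e"
      using coset_eq_iff[of e "s \<otimes> x"] x e by (simp add: m_closed m_comm)
    then have "A \<otimes>\<^bsub>?Q\<^esub> (J +> s) = \<one>\<^bsub>?Q\<^esub>"
      using x s mult by simp
    then show "\<exists>B\<in>carrier ?Q. A \<otimes>\<^bsub>?Q\<^esub> B = \<one>\<^bsub>?Q\<^esub>"
      using s by (intro bexI[of _ "J +> s"]) (auto simp: carrier)
  qed
qed

end

section \<open>Constructing ideals: Zorn's lemma and enlargement by multiples of an element\<close>

context pseudoring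
begin

lemma pseudoring_idealI:
  assumes "J \<subseteq> carrier R" "\<zero> \<in> J"
    and "\<And>a b. \<lbrakk>a \<in> J; b \<in> J\<rbrakk> \<Longrightarrow> a \<oplus> b \<in> J"
    and "\<And>a. a \<in> J \<Longrightarrow> \<ominus> a \<in> J"
    and "\<And>a x. \<lbrakk>a \<in> J; x \<in> carrier R\<rbrakk> \<Longrightarrow> a \<otimes> x \<in> J"
  shows "pseudoring_ideal J R"
proof -
  have "subgroup J (add_monoid R)"
    using assms by (intro add.subgroupI) (auto simp: a_inv_def)
  then have "abelian_subgroup J R"
    by (intro abelian_subgroupI3 additive_subgroup.intro abelian_group_axioms)
  then show ?thesis
    using assms by (simp add: pseudoring_ideal_def pseudoring_ideal_axioms_def pseudoring_axioms)
qed

lemma pseudoring_ideal_zero: "pseudoring_ideal {\<zero>} R"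
  by (rule pseudoring_idealI) (auto simp: l_null)

lemma pseudoring_ideal_Union_chain:
  assumes "\<C> \<noteq> {}" and chain: "subset.chain {J. pseudoring_ideal J R \<and> e \<notin> J} \<C>"
  shows "pseudoring_ideal (\<Union>\<C>) R"
proof (rule pseudoring_idealI)
  have ideal: "pseudoring_ideal J R" if "J \<in> \<C>" for J
    using chain that by (auto simp: subset.chain_def)
  note sub = ideal[THEN pseudoring_ideal.axioms(2), THEN abelian_subgroup.axioms(1)]
  show "\<Union>\<C> \<subseteq> carrier R"
    using additive_subgroup.a_subset[OF sub] by blast
  show "\<zero> \<in> \<Union>\<C>"
    using assms(1) additive_subgroup.zero_closed[OF sub] by blast
  fix a assume a: "a \<in> \<Union>\<C>"
  show "\<ominus> a \<in> \<Union>\<C>"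
    using a additive_subgroup.a_inv_closed[OF sub] by blast
  show "a \<otimes> x \<in> \<Union>\<C>" if "x \<in> carrier R" for x
    using a that pseudoring_ideal.I_r_closed[OF ideal] by blast
  fix b assume b: "b \<in> \<Union>\<C>"
  \<comment> \<open>Sums are the one closure property that needs comparability: a and b come from
    possibly different members, and the larger member contains both.\<close>
  obtain A B where AB: "A \<in> \<C>" "a \<in> A" "B \<in> \<C>" "b \<in> B"
    using a b by blast
  moreover have "A \<subseteq> B \<or> B \<subseteq> A"
    using AB chain by (simp add: subset_chain_def)
  ultimately obtain J where "J \<in> \<C>" "a \<in> J" "b \<in> J"
    by blast
  then show "a \<oplus> b \<in> \<Union>\<C>"
    using additive_subgroup.a_closed[OF sub] by blast
qed

text \<open>Zorn's lemma applies: the zero ideal avoids e because e is nonzero, and a union of sets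
  avoiding e avoids e.\<close>

lemma maximal_ideal_avoiding:
  assumes "e \<noteq> \<zero>"
  obtains P where "pseudoring_ideal P R" "e \<notin> P"
    "\<And>J. \<lbrakk>pseudoring_ideal J R; P \<subseteq> J; e \<notin> J\<rbrakk> \<Longrightarrow> J = P"
proof -
  let ?A = "{J. pseudoring_ideal J R \<and> e \<notin> J}"
  have "\<exists>P\<in>?A. \<forall>J\<in>?A. P \<subseteq> J \<longrightarrow> J = P"
  proof (rule subset_Zorn_nonempty)
    show "?A \<noteq> {}"
      using pseudoring_ideal_zero assms by blast
  next
    fix \<C> assume "\<C> \<noteq> {}" "subset.chain ?A \<C>"
    then show "\<Union>\<C> \<in> ?A"
      using pseudoring_ideal_Union_chain by (auto simp: subset.chain_def)
  qed
  then show thesis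
    using that by blast
qed

text \<open>Without an identity this ideal need not contain x itself; for pseudomeadows that is
  shown separately in \<open>ex_field_quotient\<close>.\<close>

lemma pseudoring_ideal_add_multiples:
  assumes "pseudoring_ideal P R" and x: "x \<in> carrier R"
  shows "pseudoring_ideal {p \<oplus> s \<otimes> x | p s. p \<in> P \<and> s \<in> carrier R} R" (is "pseudoring_ideal ?J R")
proof -
  interpret P: pseudoring_ideal P R by fact
  have memI: "p \<oplus> s \<otimes> x \<in> ?J" if "p \<in> P" "s \<in> carrier R" for p s
    using that by blast
  show ?thesis
  proof (rule pseudoring_idealI)
    show "?J \<subseteq> carrier R"
      using x by (auto simp: m_closed)
    show "\<zero> \<in> ?J"
      using memI[of \<zero> \<zero>] x by (simp add: l_null)
    fix a assume "a \<in> ?J"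
    then obtain p s where a: "p \<in> P" "s \<in> carrier R" "a = p \<oplus> s \<otimes> x"
      by blast
    then have p: "p \<in> carrier R" by simp
    show "\<ominus> a \<in> ?J"
    proof -
      have "\<ominus> a = \<ominus> p \<oplus> (\<ominus> s) \<otimes> x"
        using a p x by (simp add: l_minus m_closed minus_add)
      also have "\<dots> \<in> ?J"
        using a by (intro memI) auto
      finally show ?thesis .
    qed
    show "a \<otimes> r \<in> ?J" if "r \<in> carrier R" for r
    proof -
      have "a \<otimes> r = p \<otimes> r \<oplus> (s \<otimes> r) \<otimes> x"
        using a p x that by (simp add: l_distr m_closed m_assoc m_comm[of x r])
      also have "\<dots> \<in> ?J"
        using a that by (intro memI P.I_r_closed m_closed)
      finally show ?thesis .
    qed
    fix b assume "b \<in> ?J"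
    then obtain q t where b: "q \<in> P" "t \<in> carrier R" "b = q \<oplus> t \<otimes> x"
      by blast
    then have q: "q \<in> carrier R" by simp
    show "a \<oplus> b \<in> ?J"
    proof -
      have "a \<oplus> b = (p \<oplus> q) \<oplus> (s \<oplus> t) \<otimes> x"
        using a b p q x by (simp add: l_distr m_closed a_ac)
      also have "\<dots> \<in> ?J"
        using a b by (intro memI) auto
      finally show ?thesis .
    qed
  qed
qed

end

section \<open>Field quotients of a pseudomeadow\<close>

context pseudomeadow
begin

lemma ex_field_quotient:
  assumes a: "a \<in> carrier R" "a \<noteq> \<zero>"
  obtains P u where "pseudoring_ideal P R" "a \<notin> P" "field ((R Quot P)\<lparr>one := u\<rparr>)"
proof -
  \<comment> \<open>Since e is a multiple of a and e a = a, an ideal contains a exactly when it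
    contains e. Unlike a, the idempotent e can serve as an identity modulo an ideal.\<close>
  define e where "e = a \<otimes> pinv a"
  have e: "e \<in> carrier R"
    by (simp add: e_def a m_closed pinv_closed)
  have ea: "e \<otimes> a = a"
    using a mult_mult_pinv[of a] by (simp add: e_def pinv_closed m_assoc m_comm)
  have ee: "e \<otimes> e = e"
    using ea a e by (metis e_def m_assoc pinv_closed)
  have "e \<noteq> \<zero>"
    using ea a l_null by metis
  then obtain P where P: "pseudoring_ideal P R" "e \<notin> P"
    and max: "\<And>J. \<lbrakk>pseudoring_ideal J R; P \<subseteq> J; e \<notin> J\<rbrakk> \<Longrightarrow> J = P"
    by (rule maximal_ideal_avoiding) blast
  interpret P: pseudoring_ideal P R by fact
  have split: "\<exists>p\<in>P. \<exists>s\<in>carrier R. e = p \<oplus> s \<otimes> x" if x: "x \<in> carrier R" "x \<notin> P" for x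
  proof -
    let ?J = "{p \<oplus> s \<otimes> x | p s. p \<in> P \<and> s \<in> carrier R}"
    have "P \<subseteq> ?J"
    proof
      fix p assume "p \<in> P"
      moreover from this have "p = p \<oplus> \<zero> \<otimes> x"
        using x by (simp add: l_null)
      ultimately show "p \<in> ?J" by blast
    qed
    \<comment> \<open>The coefficient x x^(-1) replaces the identity in exhibiting x as a multiple
      of itself. So P + R x is strictly larger than P, and maximality forces e into it.\<close>
    moreover have "(x \<otimes> pinv x) \<otimes> x = x"
      using x mult_mult_pinv[of x] m_assoc m_comm pinv_closed by metis
    then have "x = \<zero> \<oplus> (x \<otimes> pinv x) \<otimes> x"
      using x by simp
    then have "x \<in> ?J"
      using x m_closed pinv_closed P.zero_closed by blast
    ultimately have "e \<in> ?J"
      using max[OF pseudoring_ideal_add_multiples[OF P(1) x(1)]] x by blast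
    then show ?thesis by blast
  qed
  have "field ((R Quot P)\<lparr>one := P +> e\<rparr>)"
  proof (rule P.quotient_fieldI[OF e P(2)])
    fix r assume r: "r \<in> carrier R"
    let ?x = "r \<oplus> \<ominus> (e \<otimes> r)"
    show "?x \<in> P"
    proof (rule ccontr)
      assume "?x \<notin> P"
      then obtain p s where ps: "p \<in> P" "s \<in> carrier R" "e = p \<oplus> s \<otimes> ?x"
        using split[of ?x] r e by (auto simp: m_closed)
      \<comment> \<open>By idempotency e (r - e r) = e r - e r; multiplying the decomposition of e
        by e therefore leaves only e p.\<close>
      have "e \<otimes> ?x = \<zero>"
        using e r l_minus[of "e \<otimes> r" e] ee
        by (simp add: r_distr m_closed m_comm[of e "\<ominus> _"] m_comm[of "e \<otimes> r" e]
            m_assoc[symmetric] r_neg)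
      moreover have "e \<otimes> e = e \<otimes> p \<oplus> s \<otimes> (e \<otimes> ?x)"
        using ps e r P.a_Hcarr r_distr[of e p "s \<otimes> ?x"] m_lcomm[of e s ?x]
        by (simp add: m_closed)
      moreover have "s \<otimes> \<zero> = \<zero>"
        using ps l_null m_comm by simp
      ultimately have "e = e \<otimes> p"
        using ee e ps by (simp add: m_closed)
      then show False
        using P(2) P.I_l_closed[OF ps(1) e] by simp
    qed
  next
    fix x assume x: "x \<in> carrier R" "x \<notin> P"
    then obtain p s where ps: "p \<in> P" "s \<in> carrier R" "e = p \<oplus> s \<otimes> x"
      using split by blast
    then have "e \<oplus> \<ominus> (s \<otimes> x) = p"
      using x by (simp add: a_assoc m_closed r_neg)
    then show "\<exists>s\<in>carrier R. e \<oplus> \<ominus> (s \<otimes> x) \<in> P"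
      using ps by blast
  qed
  moreover have "a \<notin> P"
    using P.I_r_closed[of a "pinv a"] P(2) a pinv_closed e_def by blast
  ultimately show thesis
    using that P(1) by blast
qed

end

section \<open>Embedding into the product of all field quotients\<close>

theorem theorem4p9:
  fixes R :: "('a, 'm) ring_scheme" and pinv :: "'a \<Rightarrow> 'a"
  assumes "pseudomeadow R pinv"
  shows "\<exists>(I :: 'a set set) (F :: 'a set \<Rightarrow> 'a set ring) S.
    subdirect_product_of_fields I F S \<and>
    pseudoring_iso R ((direct_product I F)\<lparr>carrier := S\<rparr>) \<noteq> {}"
proof -
  interpret pseudomeadow R pinv by fact
  \<comment> \<open>Taking every ideal with a field quotient avoids choosing one ideal per nonzero
    element. The identity u is existential because the \<open>one\<close> of R is
    unconstrained.\<close>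
  define I where "I = {P. pseudoring_ideal P R \<and> (\<exists>u. field ((R Quot P)\<lparr>one := u\<rparr>))}"
  define F where "F P = (R Quot P)\<lparr>one := SOME u. field ((R Quot P)\<lparr>one := u\<rparr>)\<rparr>" for P
  \<comment> \<open>The restriction to I is needed because the carrier of
    \<open>direct_product\<close> consists of extensional functions.\<close>
  define h where "h x = (\<lambda>P\<in>I. P +>\<^bsub>R\<^esub> x)" for x
  let ?D = "direct_product I F"
  let ?S = "h ` carrier R"
  have ideal: "pseudoring_ideal P R" if "P \<in> I" for P
    using that by (simp add: I_def)
  have field: "field (F P)" if "P \<in> I" for P
  proof -
    have "\<exists>u. field ((R Quot P)\<lparr>one := u\<rparr>)"
      using that by (simp add: I_def)
    then show ?thesis
      unfolding F_def by (rule someI_ex)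
  qed
  have carrier: "carrier (F P) = (\<lambda>x. P +>\<^bsub>R\<^esub> x) ` carrier R" for P
    by (auto simp: F_def FactRing_def A_RCOSETS_def')
  interpret D: pseudoring ?D
    using field by (intro pseudoring_direct_product pseudoring_field)
  have h_closed: "h x \<in> carrier ?D" if "x \<in> carrier R" for x
    using that by (auto simp: direct_product_def h_def carrier)
  have h_mult: "h (x \<otimes>\<^bsub>R\<^esub> y) = h x \<otimes>\<^bsub>?D\<^esub> h y" if "x \<in> carrier R" "y \<in> carrier R" for x y
    using that pseudoring_ideal.rcoset_mult_eq[OF ideal]
    by (auto simp: direct_product_def h_def F_def FactRing_def intro!: restrict_ext)
  have h_add: "h (x \<oplus>\<^bsub>R\<^esub> y) = h x \<oplus>\<^bsub>?D\<^esub> h y" if "x \<in> carrier R" "y \<in> carrier R" for x y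
    using that abelian_subgroup.a_rcos_sum[OF pseudoring_ideal.axioms(2)[OF ideal]]
    by (auto simp: direct_product_def h_def F_def FactRing_def intro!: restrict_ext)
  \<comment> \<open>Additivity yields the images of zero and of negatives, from which the image of h
    inherits closure.\<close>
  interpret h: abelian_group_hom R ?D h
    by (intro abelian_group_homI group_hom.intro group_hom_axioms.intro a_group D.a_group
        abelian_group_axioms D.abelian_group_axioms) (auto simp: hom_def h_closed h_add)
  \<comment> \<open>If x and y differ, the nonzero x - y lies outside some P in I, so their cosets
    modulo P differ.\<close>
  have "inj_on h (carrier R)"
  proof (rule inj_onI, rule ccontr)
    fix x y assume xy: "x \<in> carrier R" "y \<in> carrier R" "h x = h y" "x \<noteq> y"
    then have "x \<oplus>\<^bsub>R\<^esub> \<ominus>\<^bsub>R\<^esub> y \<noteq> \<zero>\<^bsub>R\<^esub>"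
      by (metis a_inv_closed minus_equality minus_minus)
    then obtain P u where P: "pseudoring_ideal P R" "x \<oplus>\<^bsub>R\<^esub> \<ominus>\<^bsub>R\<^esub> y \<notin> P"
        "field ((R Quot P)\<lparr>one := u\<rparr>)"
      using ex_field_quotient xy by (metis a_closed a_inv_closed)
    then have "P \<in> I"
      by (auto simp: I_def)
    then have "P +>\<^bsub>R\<^esub> x = P +>\<^bsub>R\<^esub> y"
      using xy(3) by (metis h_def restrict_apply')
    then show False
      using pseudoring_ideal.coset_eq_iff[OF P(1)] P(2) xy by blast
  qed
  then have "h \<in> pseudoring_iso R (?D\<lparr>carrier := ?S\<rparr>)"
    by (auto simp: pseudoring_iso_def bij_betw_def h_mult)
  moreover have "subpseudoring ?S ?D"
  proof
    show "?S \<subseteq> carrier ?D"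
      using h_closed by blast
    show "\<zero>\<^bsub>?D\<^esub> \<in> ?S"
      using h.hom_zero zero_closed by (metis image_eqI)
  next
    fix x y assume "x \<in> ?S" "y \<in> ?S"
    then show "x \<oplus>\<^bsub>?D\<^esub> y \<in> ?S" "x \<otimes>\<^bsub>?D\<^esub> y \<in> ?S"
      using a_closed m_closed by (auto simp flip: h_mult h_add)
  next
    fix x assume "x \<in> ?S"
    then show "\<ominus>\<^bsub>?D\<^esub> x \<in> ?S"
      using a_inv_closed by (auto simp flip: h.hom_a_inv)
  qed
  \<comment> \<open>Each element of F P is a coset P + x, which is the P-component of h x.\<close>
  moreover have "\<exists>x\<in>?S. x P = y" if "P \<in> I" "y \<in> carrier (F P)" for P y
    using that by (auto simp: carrier h_def)
  ultimately have "subdirect_product_of_fields I F ?S"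
    using field pseudoring_field[OF field]
    by (simp add: subdirect_product_of_fields_def subdirect_product_of_fields_axioms_def
        subdirect_product_def)
  then show ?thesis
    using \<open>h \<in> _\<close> by blast
qed

end
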